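(* $\mathcal{M}^{eds}$ is strongly internal: for every infinite bounded $H\subset\mathbb{R}$ for which $\mathcal{M}^{eds}(H)$ exists, $\varliminf H\le\mathcal{M}^{eds}(H)\le\varlimsup H$.
   Context: For a finite nonempty set $F\subset\mathbb{R}$, $\mathcal{A}(F)$ is the arithmetic mean of its elements. For infinite bounded $H$, $\varliminf H=\inf H'$, $\varlimsup H=\sup H'$, where $H'$ is the set of accumulation points of $H$. Definition of $\mathcal{M}^{eds}$: let $H\subset\mathbb{R}$ be bounded, $a=\inf H$, $b=\sup H$. For $n\in\mathbb{N}$, $0\le i\le n-1$ set $H_{n,i}=H\cap[a+\frac{i}{n}(b-a),a+\frac{i+1}{n}(b-a))$ and $I_n=\{0\le i\le n-1:H_{n,i}\ne\emptyset\}$. We say $\mathcal{M}^{eds}(H)=k$ if for every $\epsilon>0$ there is $N\in\mathbb{N}$ such that for all $n>N$ and all choices $\xi_i\in H_{n,i}$ $(i\in I_n)$ we have $|\mathcal{A}(\{\xi_i:i\in I_n\})-k|<\epsilon$. $\mathcal{M}^{eds}(H)$ exists if there is such a $k\in\mathbb{R}$. *)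

theory Defs
  imports "HOL-Analysis.Analysis"
begin

definition accumulation_points :: "real set \<Rightarrow> real set" where
  "accumulation_points H = {x. x islimpt H}"

definition lower_lim :: "real set \<Rightarrow> real" where
  "lower_lim H = Inf (accumulation_points H)"

definition upper_lim :: "real set \<Rightarrow> real" where
  "upper_lim H = Sup (accumulation_points H)"

text \<open>For finite nonempty sets; on the empty set the value is the junk value 0.\<close>
definition arith_mean :: "real set \<Rightarrow> real" where
  "arith_mean F = (\<Sum>x\<in>F. x) / real (card F)"

definition eds_cell :: "real set \<Rightarrow> nat \<Rightarrow> nat \<Rightarrow> real set" where
  "eds_cell H n i =
     H \<inter> {Inf H + real i / real n * (Sup H - Inf H) ..<
          Inf H + (real i + 1) / real n * (Sup H - Inf H)}"

definition eds_index :: "real set \<Rightarrow> nat \<Rightarrow> nat set" where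
  "eds_index H n = {i. i < n \<and> eds_cell H n i \<noteq> {}}"

text \<open>
  Intended for bounded sets with at least two elements. If \<open>H\<close> has at most one
  element, then all cells are empty, the mean of the empty set is taken, and the
  predicate has no mathematical meaning.
\<close>
definition has_Meds :: "real set \<Rightarrow> real \<Rightarrow> bool" where
  "has_Meds H k \<longleftrightarrow>
     (\<forall>\<epsilon>>0. \<exists>N::nat. \<forall>n>N. \<forall>\<xi>::nat \<Rightarrow> real.
        (\<forall>i\<in>eds_index H n. \<xi> i \<in> eds_cell H n i) \<longrightarrow>
        \<bar>arith_mean (\<xi> ` eds_index H n) - k\<bar> < \<epsilon>)"

definition Meds_exists :: "real set \<Rightarrow> bool" where
  "Meds_exists H \<longleftrightarrow> (\<exists>k. has_Meds H k)"

definition Meds :: "real set \<Rightarrow> real" where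
  "Meds H = (THE k. has_Meds H k)"

text \<open>
  A mean is a partial function on sets of reals, given by its domain \<open>D\<close> and a
  total function \<open>K\<close> whose values outside \<open>D\<close> are irrelevant.
\<close>
definition strongly_internal :: "real set set \<Rightarrow> (real set \<Rightarrow> real) \<Rightarrow> bool" where
  "strongly_internal D K \<longleftrightarrow>
     (\<forall>H\<in>D. infinite H \<and> bounded H \<longrightarrow> lower_lim H \<le> K H \<and> K H \<le> upper_lim H)"

end

theory Submission
  imports Defs
begin

text \<open>
  Only finitely many elements of \<open>H\<close> lie above any \<open>t > upper_lim H\<close>, so their total
  contribution to the sum over the chosen points is bounded. The number of nonempty
  cells tends to infinity, hence this contribution vanishes in the mean and the limit
  is at most \<open>t\<close>. The lower bound is symmetric.
\<close>

lemma arith_mean_limit_le: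
  fixes F :: "nat \<Rightarrow> real set"
  assumes fin: "finite {x\<in>H. x > t}"
    and F: "\<And>n. finite (F n)" "\<And>n. F n \<subseteq> H"
    and card: "filterlim (\<lambda>n. card (F n)) at_top sequentially"
    and lim: "(\<lambda>n. arith_mean (F n)) \<longlonglongrightarrow> k"
  shows "k \<le> t"
proof -
  \<comment> \<open>\<open>D\<close> is the total excess over \<open>t\<close>. It does not depend
    on \<open>n\<close>, and it is finite data by \<open>fin\<close>.\<close>
  define D where "D = (\<Sum>x\<in>{x\<in>H. x > t}. x - t)"
  have bound: "arith_mean (F n) \<le> t + D / real (card (F n))" if "card (F n) \<ge> 1" for n
  proof -
    \<comment> \<open>Points not above \<open>t\<close> contribute nonpositive terms.
      \<open>sum.inter_restrict\<close> replaces these terms by 0 on the right, so both sums run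
      over \<open>F n\<close> and compare termwise.\<close>
    have "(\<Sum>x\<in>F n. x - t) \<le> (\<Sum>x\<in>F n \<inter> {x. x > t}. x - t)"
      unfolding sum.inter_restrict[OF F(1)] by (intro sum_mono) auto
    also have "\<dots> \<le> D"
      unfolding D_def using F(2)[of n] by (intro sum_mono2 fin) auto
    finally have "(\<Sum>x\<in>F n. x) \<le> real (card (F n)) * t + D"
      by (simp add: sum_subtractf)
    then show ?thesis
      using that by (simp add: arith_mean_def field_simps)
  qed
  have "filterlim (\<lambda>n. real (card (F n))) at_top sequentially"
    using card by (rule filterlim_compose[OF filterlim_real_sequentially])
  then have "(\<lambda>n. D / real (card (F n))) \<longlonglongrightarrow> 0"
    by (intro tendsto_divide_0[OF tendsto_const] filterlim_at_top_imp_at_infinity)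
  then have "(\<lambda>n. t + D / real (card (F n))) \<longlonglongrightarrow> t + 0"
    by (intro tendsto_intros)
  moreover have "\<forall>\<^sub>F n in sequentially. arith_mean (F n) \<le> t + D / real (card (F n))"
    using card[unfolded filterlim_at_top, rule_format, of 1]
    by eventually_elim (rule bound)
  ultimately show ?thesis
    using tendsto_le[OF _ _ lim] by auto
qed

lemma arith_mean_uminus: "arith_mean (uminus ` F) = - arith_mean F"
  by (simp add: arith_mean_def sum.reindex card_image sum_negf)

text \<open>The reflection \<open>uminus\<close> carries this to the upper bound.\<close>

lemma arith_mean_limit_ge:
  fixes F :: "nat \<Rightarrow> real set"
  assumes fin: "finite {x\<in>H. x < t}"
    and F: "\<And>n. finite (F n)" "\<And>n. F n \<subseteq> H"
    and card: "filterlim (\<lambda>n. card (F n)) at_top sequentially"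
    and lim: "(\<lambda>n. arith_mean (F n)) \<longlonglongrightarrow> k"
  shows "t \<le> k"
proof -
  have "- k \<le> - t"
  proof (rule arith_mean_limit_le)
    have "{x \<in> uminus ` H. - t < x} = uminus ` {x\<in>H. x < t}"
      by auto
    then show "finite {x \<in> uminus ` H. - t < x}"
      using fin by simp
    show "uminus ` F n \<subseteq> uminus ` H" for n
      using F(2) by (rule image_mono)
    show "filterlim (\<lambda>n. card (uminus ` F n)) at_top sequentially"
      using card by (simp add: card_image)
    show "(\<lambda>n. arith_mean (uminus ` F n)) \<longlonglongrightarrow> - k"
      using tendsto_minus[OF lim] by (simp add: arith_mean_uminus)
  qed (simp add: F)
  then show ?thesis by simp
qed

text \<open>Makes \<open>Sup\<close> and \<open>Inf\<close> of the accumulation points genuine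
  bounds for them.\<close>

lemma bounded_accumulation_points:
  assumes "bounded H"
  shows "bounded (accumulation_points H)"
proof (rule bounded_subset)
  show "bounded (closure H)"
    using assms by (rule bounded_closure)
  show "accumulation_points H \<subseteq> closure H"
    by (auto simp: accumulation_points_def closure_def)
qed

text \<open>By Bolzano-Weierstrass, infinitely many elements above \<open>t\<close> would accumulate
  at some \<open>x\<close>. Closedness of \<open>{t..}\<close> gives \<open>t \<le> x\<close>, while
  \<open>x\<close> is also an accumulation point of \<open>H\<close>, so it cannot exceed
  \<open>upper_lim H\<close>.\<close>

lemma finite_above_upper_lim:
  assumes "bounded H" "upper_lim H < t"
  shows "finite {x\<in>H. x > t}"
proof (rule ccontr)
  assume "infinite {x\<in>H. x > t}"
  moreover have "bounded {x\<in>H. x > t}"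
    by (rule bounded_subset[OF assms(1)]) auto
  ultimately obtain x where x: "x islimpt {x\<in>H. x > t}"
    using bounded_infinite_imp_islimpt[OF order_refl] by blast
  have "x islimpt {t..}"
    using x by (rule islimpt_subset) auto
  then have "t \<le> x"
    using closed_limpt[of "{t..}"] by auto
  moreover have "x \<in> accumulation_points H"
    unfolding accumulation_points_def using islimpt_subset[OF x, of H] by auto
  then have "x \<le> upper_lim H"
    unfolding upper_lim_def
    by (intro cSup_upper bounded_imp_bdd_above bounded_accumulation_points assms(1))
  ultimately show False
    using assms(2) by simp
qed

lemma finite_below_lower_lim:
  assumes "bounded H" "t < lower_lim H"
  shows "finite {x\<in>H. x < t}"
proof (rule ccontr)
  assume "infinite {x\<in>H. x < t}"
  moreover have "bounded {x\<in>H. x < t}"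
    by (rule bounded_subset[OF assms(1)]) auto
  ultimately obtain x where x: "x islimpt {x\<in>H. x < t}"
    using bounded_infinite_imp_islimpt[OF order_refl] by blast
  have "x islimpt {..t}"
    using x by (rule islimpt_subset) auto
  then have "x \<le> t"
    using closed_limpt[of "{..t}"] by auto
  moreover have "x \<in> accumulation_points H"
    unfolding accumulation_points_def using islimpt_subset[OF x, of H] by auto
  then have "lower_lim H \<le> x"
    unfolding lower_lim_def
    by (intro cInf_lower bounded_imp_bdd_below bounded_accumulation_points assms(1))
  ultimately show False
    using assms(2) by simp
qed

text \<open>Guarantees that the cells have positive length.\<close>

lemma Inf_less_Sup:
  fixes H :: "real set"
  assumes "infinite H" "bounded H"
  shows "Inf H < Sup H"
proof -
  obtain x where x: "x \<in> H"
    using assms(1) by (metis ex_in_conv finite.emptyI)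
  obtain y where y: "y \<in> H" "y \<noteq> x"
    using assms(1) by (metis finite.emptyI finite_insert finite_subset singletonI subsetI)
  have "Inf H \<le> z" "z \<le> Sup H" if "z \<in> H" for z
    using that assms(2)
    by (auto intro: cInf_lower cSup_upper bounded_imp_bdd_below bounded_imp_bdd_above)
  from this[OF x] this[OF y(1)] y(2) show ?thesis by linarith
qed

text \<open>Cells are level sets of a floor function, so disjointness of cells and separation of
  points reduce to comparing floors.\<close>

lemma mem_eds_cell_iff:
  assumes "n > 0" "Inf H < Sup H"
  shows "x \<in> eds_cell H n i \<longleftrightarrow>
    x \<in> H \<and> \<lfloor>real n * (x - Inf H) / (Sup H - Inf H)\<rfloor> = int i"
  using assms by (auto simp: eds_cell_def floor_eq_iff field_simps)

lemma finite_eds_index [simp]: "finite (eds_index H n)"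
  by (simp add: eds_index_def)

text \<open>Cells with different indices are disjoint. The mean is taken over the image set, so
  injectivity is what makes its cardinality equal to the number of nonempty cells.\<close>

lemma inj_on_eds_choice:
  assumes "Inf H < Sup H" "\<And>i. i \<in> eds_index H n \<Longrightarrow> \<xi> i \<in> eds_cell H n i"
  shows "inj_on \<xi> (eds_index H n)"
proof (rule inj_onI)
  fix i j assume ij: "i \<in> eds_index H n" "j \<in> eds_index H n" "\<xi> i = \<xi> j"
  then have "n > 0"
    by (auto simp: eds_index_def)
  with ij assms(2)[OF ij(1)] assms(2)[OF ij(2)] show "i = j"
    by (simp add: mem_eds_cell_iff[OF _ assms(1)])
qed

text \<open>On a fine enough grid the points of \<open>T\<close> fall into pairwise distinct cells.
  \<open>Sup H\<close> is left out because the half-open cells with index below \<open>n\<close>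
  miss it.\<close>

lemma card_eds_index_ge:
  assumes T: "finite T" "T \<subseteq> H - {Sup H}" and H: "bounded H" "Inf H < Sup H"
  shows "\<forall>\<^sub>F n in sequentially. card T \<le> card (eds_index H n)"
proof -
  define g where "g n x = real n * (x - Inf H) / (Sup H - Inf H)" for n :: nat and x
  have sep: "\<forall>\<^sub>F n in sequentially. \<lfloor>g n x\<rfloor> = \<lfloor>g n y\<rfloor> \<longrightarrow> x = y" for x y
  proof (cases "x = y")
    case False
    \<comment> \<open>From this threshold on, the rescaled coordinates of \<open>x\<close> and
      \<open>y\<close> are at least 1 apart, so their floors differ.\<close>
    have "\<forall>\<^sub>F n in sequentially. real n \<ge> (Sup H - Inf H) / \<bar>x - y\<bar>"
      by (rule eventually_ge_at_top[THEN eventually_compose_filterlim[OF _ filterlim_real_sequentially]])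
    then show ?thesis
    proof eventually_elim
      case (elim n)
      have "g n x - g n y = real n * (x - y) / (Sup H - Inf H)"
        by (simp add: g_def field_simps flip: diff_divide_distrib)
      then have "\<bar>g n x - g n y\<bar> = real n * \<bar>x - y\<bar> / (Sup H - Inf H)"
        using H(2) by (simp add: abs_mult)
      then have "\<bar>g n x - g n y\<bar> \<ge> 1"
        using elim False H(2) by (simp only: le_divide_eq_1 divide_le_eq) simp
      then show ?case by linarith
    qed
  qed simp
  have "\<forall>\<^sub>F n in sequentially. \<forall>x\<in>T. \<forall>y\<in>T. \<lfloor>g n x\<rfloor> = \<lfloor>g n y\<rfloor> \<longrightarrow> x = y"
    by (intro eventually_ball_finite[OF T(1)] ballI sep)
  then show ?thesis
    using eventually_gt_at_top[of 0]
  proof eventually_elim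
    case (elim n)
    \<comment> \<open>The lower bound ensures that \<open>nat\<close> loses nothing on the floors;
      the strict upper bound, from \<open>x \<noteq> Sup H\<close>, keeps the index below
      \<open>n\<close>.\<close>
    have cell: "0 \<le> g n x \<and> g n x < real n" if "x \<in> T" for x
    proof -
      have "x \<in> H" "x \<noteq> Sup H"
        using that T(2) by auto
      then have "Inf H \<le> x" "x < Sup H"
        using H(1) cSup_upper[of x H]
        by (auto intro: cInf_lower bounded_imp_bdd_below simp: bounded_imp_bdd_above less_le)
      then show ?thesis
        using H(2) elim(2) by (simp add: g_def field_simps)
    qed
    have "inj_on (\<lambda>x. nat \<lfloor>g n x\<rfloor>) T"
      using elim(1) cell by (auto intro!: inj_onI simp: eq_nat_nat_iff)
    moreover have "(\<lambda>x. nat \<lfloor>g n x\<rfloor>) ` T \<subseteq> eds_index H n"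
    proof
      fix i assume "i \<in> (\<lambda>x. nat \<lfloor>g n x\<rfloor>) ` T"
      then obtain x where x: "x \<in> T" "i = nat \<lfloor>g n x\<rfloor>" by auto
      have "int i = \<lfloor>g n x\<rfloor>" "i < n"
        using cell[OF x(1)] x(2) by (simp_all, linarith)
      moreover from this x(1) T(2) have "x \<in> eds_cell H n i"
        by (auto simp: mem_eds_cell_iff[OF elim(2) H(2)] g_def)
      ultimately show "i \<in> eds_index H n"
        by (auto simp: eds_index_def)
    qed
    ultimately show ?case
      by (rule card_inj_on_le) simp
  qed
qed

text \<open>Removing one point leaves \<open>H\<close> infinite, so it still contains finite sets
  \<open>T\<close> of every size.\<close>

lemma filterlim_card_eds_index:
  assumes "infinite H" "bounded H"
  shows "filterlim (\<lambda>n. card (eds_index H n)) at_top sequentially"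
  unfolding filterlim_at_top
proof
  fix m
  have "infinite (H - {Sup H})"
    using assms(1) by simp
  then obtain T where "finite T" "card T = m" "T \<subseteq> H - {Sup H}"
    using infinite_arbitrarily_large by blast
  then show "\<forall>\<^sub>F n in sequentially. m \<le> card (eds_index H n)"
    using card_eds_index_ge[of T H] Inf_less_Sup[OF assms] assms(2) by auto
qed

text \<open>Fixing one choice of points for each \<open>n\<close> turns the condition uniform over
  all choices into an ordinary limit.\<close>

lemma has_Meds_tendsto:
  assumes "has_Meds H k" "\<And>n i. i \<in> eds_index H n \<Longrightarrow> \<xi> n i \<in> eds_cell H n i"
  shows "(\<lambda>n. arith_mean (\<xi> n ` eds_index H n)) \<longlonglongrightarrow> k"
  unfolding lim_sequentially dist_real_def
proof (intro allI impI)
  fix e :: real assume "e > 0"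
  then obtain N where "\<And>n. n > N \<Longrightarrow> \<bar>arith_mean (\<xi> n ` eds_index H n) - k\<bar> < e"
    using assms unfolding has_Meds_def by meson
  then show "\<exists>N. \<forall>n\<ge>N. \<bar>arith_mean (\<xi> n ` eds_index H n) - k\<bar> < e"
    \<comment> \<open>\<open>has_Meds_def\<close> speaks of \<open>n > N\<close>, the limit of
      \<open>n \<ge> N\<close>; hence the shift.\<close>
    by (intro exI[of _ "Suc N"]) auto
qed

text \<open>Shows that the quantification over choices in \<open>has_Meds\<close> is never
  vacuous.\<close>

lemma eds_choice_exists:
  obtains \<xi> where "\<And>n i. i \<in> eds_index H n \<Longrightarrow> \<xi> n i \<in> eds_cell H n i"
proof
  show "(SOME x. x \<in> eds_cell H n i) \<in> eds_cell H n i" if "i \<in> eds_index H n" for n i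
    using that by (auto simp: eds_index_def some_in_eq)
qed

text \<open>Any two candidate values are limits of the same sequence of means, so the definite
  description in \<open>Meds\<close> is determined.\<close>

lemma Meds_eq:
  assumes "has_Meds H k"
  shows "Meds H = k"
proof -
  obtain \<xi> where \<xi>: "\<And>n i. i \<in> eds_index H n \<Longrightarrow> \<xi> n i \<in> eds_cell H n i"
    using eds_choice_exists[of H] by blast
  show ?thesis
    unfolding Meds_def using assms
  proof (rule the_equality)
    fix k' assume "has_Meds H k'"
    then show "k' = k"
      using LIMSEQ_unique has_Meds_tendsto[OF _ \<xi>] assms by metis
  qed
qed

theorem theorem6p3: "strongly_internal {H. bounded H \<and> Meds_exists H} Meds"
  unfolding strongly_internal_def
proof (intro ballI impI)
  fix H assume "H \<in> {H. bounded H \<and> Meds_exists H}" and H: "infinite H \<and> bounded H"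
  then obtain k where k: "has_Meds H k"
    by (auto simp: Meds_exists_def)
  obtain \<xi> where \<xi>: "\<And>n i. i \<in> eds_index H n \<Longrightarrow> \<xi> n i \<in> eds_cell H n i"
    using eds_choice_exists[of H] by blast
  define F where "F n = \<xi> n ` eds_index H n" for n
  have fin: "finite (F n)" for n
    by (simp add: F_def)
  have sub: "F n \<subseteq> H" for n
    using \<xi> by (force simp: F_def eds_cell_def)
  have "inj_on (\<xi> n) (eds_index H n)" for n
    using inj_on_eds_choice[OF _ \<xi>] Inf_less_Sup H by blast
  then have card: "filterlim (\<lambda>n. card (F n)) at_top sequentially"
    using filterlim_card_eds_index H by (simp add: F_def card_image)
  have lim: "(\<lambda>n. arith_mean (F n)) \<longlonglongrightarrow> k"
    unfolding F_def using k \<xi> by (rule has_Meds_tendsto)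
  \<comment> \<open>Finiteness holds only strictly beyond the two limits, so \<open>k\<close> is
    first compared with such \<open>t\<close>; density of the reals then gives the bounds at the
    limits themselves.\<close>
  have "k \<le> t" if "upper_lim H < t" for t
    using arith_mean_limit_le[OF finite_above_upper_lim[OF _ that] fin sub card lim] H by blast
  moreover have "t \<le> k" if "t < lower_lim H" for t
    using arith_mean_limit_ge[OF finite_below_lower_lim[OF _ that] fin sub card lim] H by blast
  ultimately have "lower_lim H \<le> k \<and> k \<le> upper_lim H"
    by (meson dense_ge dense_le)
  then show "lower_lim H \<le> Meds H \<and> Meds H \<le> upper_lim H"
    by (simp add: Meds_eq[OF k])
qed

end
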